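(* Let $G$ be a finitely generated group and let $H = H_1(G,\mathbb{Z}) \cong G/[G,G]$. Suppose that $H \cong H_1 \oplus \cdots \oplus H_k$ for subgroups $H_1, \ldots, H_k$ of $H$, and that for each $i = 1, \ldots, k$ we are given a set $S_i \subset G$ whose projection to $H$ is contained in $H_i$ and generates $H_i$ with finite diameter. Then $G$ is nilpotent-bounded with respect to $S_1 \cup \cdots \cup S_k$.
   Context: A (possibly infinite) subset $T$ of a group $Q$ generates $Q$ with finite diameter if there is a constant $C$ such that every element of $Q$ is a product of at most $C$ elements of $T \cup T^{-1}$; equivalently, $T$ generates $Q$ and $Q$ has finite diameter in the word metric given by $T$. A group $G$ is called nilpotent-bounded with respect to a set $S \subset G$ if every nilpotent quotient of $G$ has finite diameter with respect to the word metric given by the image of $S$ in that quotient. *)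

theory Defs
  imports "HOL-Algebra.Algebra"
begin

definition finitely_generated_group :: "('a, 'b) monoid_scheme \<Rightarrow> bool" where
  "finitely_generated_group G \<longleftrightarrow>
     group G \<and> (\<exists>A. finite A \<and> A \<subseteq> carrier G \<and> generate G A = carrier G)"

definition generates_with_finite_diameter :: "('a, 'b) monoid_scheme \<Rightarrow> 'a set \<Rightarrow> bool" where
  "generates_with_finite_diameter Q T \<longleftrightarrow>
     T \<subseteq> carrier Q \<and>
     (\<exists>C::nat. \<forall>q \<in> carrier Q. \<exists>xs.
        set xs \<subseteq> T \<union> m_inv Q ` T \<and> length xs \<le> C \<and>
        q = foldr (\<otimes>\<^bsub>Q\<^esub>) xs \<one>\<^bsub>Q\<^esub>)"

text \<open>The term with index \<open>n\<close> is the usual \<open>\<gamma>\<close> of index \<open>n + 1\<close>; the commutator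
  convention is that of \<^const>\<open>derived\<close>.\<close>

primrec lower_central :: "('a, 'b) monoid_scheme \<Rightarrow> nat \<Rightarrow> 'a set" where
  "lower_central G 0 = carrier G"
| "lower_central G (Suc n) = generate G
     (\<Union>x \<in> lower_central G n. \<Union>y \<in> carrier G.
        {x \<otimes>\<^bsub>G\<^esub> y \<otimes>\<^bsub>G\<^esub> (inv\<^bsub>G\<^esub> x) \<otimes>\<^bsub>G\<^esub> (inv\<^bsub>G\<^esub> y)})"

definition nilpotent_group :: "('a, 'b) monoid_scheme \<Rightarrow> bool" where
  "nilpotent_group G \<longleftrightarrow> group G \<and> (\<exists>n. lower_central G n = {\<one>\<^bsub>G\<^esub>})"

definition coset_proj :: "('a, 'b) monoid_scheme \<Rightarrow> 'a set \<Rightarrow> 'a \<Rightarrow> 'a set" where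
  "coset_proj G N g = N #>\<^bsub>G\<^esub> g"

definition nilpotent_bounded :: "('a, 'b) monoid_scheme \<Rightarrow> 'a set \<Rightarrow> bool" where
  "nilpotent_bounded G S \<longleftrightarrow>
     S \<subseteq> carrier G \<and>
     (\<forall>N. N \<lhd> G \<and> nilpotent_group (G Mod N) \<longrightarrow>
        generates_with_finite_diameter (G Mod N) (coset_proj G N ` S))"

text \<open>The first homology of \<open>G\<close> with integer coefficients, identified with the abelianization,
  so that the projection from \<open>G\<close> is the quotient map.\<close>

definition abelianization :: "('a, 'b) monoid_scheme \<Rightarrow> 'a set monoid" where
  "abelianization G = G Mod derived G (carrier G)"

text \<open>Internal direct sum: the canonical map from the external direct sum, which multiplies the
  components, is an isomorphism. As \<^const>\<open>finprod\<close> is involved, this is meaningful only for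
  commutative \<open>H\<close> and finite \<open>I\<close>.\<close>

definition internal_direct_sum ::
    "('a, 'b) monoid_scheme \<Rightarrow> 'i set \<Rightarrow> ('i \<Rightarrow> 'a set) \<Rightarrow> bool" where
  "internal_direct_sum H I Hs \<longleftrightarrow>
     (\<forall>i\<in>I. subgroup (Hs i) H) \<and>
     (\<lambda>x. finprod H x I) \<in> iso (sum_group I (\<lambda>i. H\<lparr>carrier := Hs i\<rparr>)) H"

end

theory Submission
  imports Defs
begin

text \<open>It suffices that the union \<open>S\<close> of the \<open>S\<^sub>i\<close> generates \<open>G/[G,G]\<close> with finite diameter; the
  number of letters needed in a direct sum is at most the sum of the numbers needed in the summands.
  Write \<open>\<gamma>\<^sub>1 = G\<close> and \<open>\<gamma>\<^bsub>n+1\<^esub> = [\<gamma>\<^sub>n, G]\<close>. As \<open>G\<close> is finitely generated, \<open>\<gamma>\<^sub>n/\<gamma>\<^bsub>n+1\<^esub>\<close> is generated by a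
  finite set \<open>A\<close>, which can be taken to consist of words in \<open>S\<close>. The commutator is bilinear from
  \<open>\<gamma>\<^sub>n/\<gamma>\<^bsub>n+1\<^esub> \<times> G/\<gamma>\<^sub>2\<close> to \<open>\<gamma>\<^bsub>n+1\<^esub>/\<gamma>\<^bsub>n+2\<^esub>\<close>, so modulo \<open>\<gamma>\<^bsub>n+2\<^esub>\<close> every element of \<open>\<gamma>\<^bsub>n+1\<^esub>\<close> is a product of
  commutators \<open>[a, h\<^sub>a]\<close>, one for each \<open>a \<in> A\<close>, where \<open>h\<^sub>a\<close> matters only modulo \<open>\<gamma>\<^sub>2\<close> and hence can be a
  word of bounded length. So \<open>\<gamma>\<^bsub>n+1\<^esub>\<close> is covered by words of bounded length modulo \<open>\<gamma>\<^bsub>n+2\<^esub>\<close>, and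
  inductively \<open>G\<close> is covered by words of bounded length modulo each \<open>\<gamma>\<^sub>n\<close>.\<close>

section \<open>Words of bounded length\<close>

definition word_ball :: "('a, 'b) monoid_scheme \<Rightarrow> 'a set \<Rightarrow> nat \<Rightarrow> 'a set" where
  "word_ball G S C =
     {foldr (\<otimes>\<^bsub>G\<^esub>) xs \<one>\<^bsub>G\<^esub> | xs. set xs \<subseteq> S \<union> m_inv G ` S \<and> length xs \<le> C}"

lemma generates_with_finite_diameter_iff:
  "generates_with_finite_diameter Q T \<longleftrightarrow>
     T \<subseteq> carrier Q \<and> (\<exists>C. carrier Q \<subseteq> word_ball Q T C)"
  unfolding generates_with_finite_diameter_def word_ball_def by blast

lemma word_ball_mono:
  assumes "S \<subseteq> T" "C \<le> D"
  shows "word_ball G S C \<subseteq> word_ball G T D"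
  unfolding word_ball_def using assms by fastforce

context group
begin

lemma foldr_mult_closed:
  "set xs \<subseteq> carrier G \<Longrightarrow> foldr (\<otimes>) xs \<one> \<in> carrier G"
  by (induction xs) auto

lemma foldr_mult_append:
  "\<lbrakk>set xs \<subseteq> carrier G; set ys \<subseteq> carrier G\<rbrakk> \<Longrightarrow>
     foldr (\<otimes>) (xs @ ys) \<one> = foldr (\<otimes>) xs \<one> \<otimes> foldr (\<otimes>) ys \<one>"
  by (induction xs) (auto simp: m_assoc foldr_mult_closed simp del: foldr_append)

lemma inv_foldr_mult:
  "set xs \<subseteq> carrier G \<Longrightarrow>
     inv (foldr (\<otimes>) xs \<one>) = foldr (\<otimes>) (rev (map (m_inv G) xs)) \<one>"
proof (induction xs)
  case (Cons x xs)
  have "foldr (\<otimes>) (rev (map (m_inv G) (x # xs))) \<one>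
      = foldr (\<otimes>) (rev (map (m_inv G) xs) @ [inv x]) \<one>" by simp
  also have "\<dots> = foldr (\<otimes>) (rev (map (m_inv G) xs)) \<one> \<otimes> foldr (\<otimes>) [inv x] \<one>"
    by (rule foldr_mult_append) (use Cons.prems in auto)
  also have "\<dots> = inv (foldr (\<otimes>) xs \<one>) \<otimes> inv x"
    using Cons by simp
  also have "\<dots> = inv (foldr (\<otimes>) (x # xs) \<one>)"
    using Cons.prems by (simp add: inv_mult_group foldr_mult_closed)
  finally show ?case by simp
qed simp

context
  fixes S assumes S: "S \<subseteq> carrier G"
begin

lemma letters_in_carrier: "S \<union> m_inv G ` S \<subseteq> carrier G"
  using S by auto

lemma word_ball_in_carrier: "word_ball G S C \<subseteq> carrier G"
  unfolding word_ball_def using foldr_mult_closed letters_in_carrier by (blast dest: subset_trans)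

lemma one_in_word_ball: "\<one> \<in> word_ball G S C"
  unfolding word_ball_def by (auto intro: exI[of _ "[]"])

lemma word_ball_mult:
  assumes "x \<in> word_ball G S C" "y \<in> word_ball G S D"
  shows "x \<otimes> y \<in> word_ball G S (C + D)"
proof -
  obtain xs ys where
    "set xs \<subseteq> S \<union> m_inv G ` S" "length xs \<le> C" "x = foldr (\<otimes>) xs \<one>"
    "set ys \<subseteq> S \<union> m_inv G ` S" "length ys \<le> D" "y = foldr (\<otimes>) ys \<one>"
    using assms unfolding word_ball_def by blast
  then have "set (xs @ ys) \<subseteq> S \<union> m_inv G ` S" "length (xs @ ys) \<le> C + D"
    "x \<otimes> y = foldr (\<otimes>) (xs @ ys) \<one>"
    using foldr_mult_append[of xs ys] letters_in_carrier by (simp_all add: subset_trans del: foldr_append)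
  then show ?thesis unfolding word_ball_def by blast
qed

lemma word_ball_inv:
  assumes "x \<in> word_ball G S C"
  shows "inv x \<in> word_ball G S C"
proof -
  obtain xs where xs: "set xs \<subseteq> S \<union> m_inv G ` S" "length xs \<le> C" "x = foldr (\<otimes>) xs \<one>"
    using assms unfolding word_ball_def by blast
  have "set (rev (map (m_inv G) xs)) \<subseteq> S \<union> m_inv G ` S"
  proof -
    have "inv (inv s) = s" if "s \<in> S" for s using that S by auto
    then show ?thesis using xs(1) by fastforce
  qed
  moreover have "inv x = foldr (\<otimes>) (rev (map (m_inv G) xs)) \<one>"
    using xs inv_foldr_mult letters_in_carrier by (metis subset_trans)
  ultimately show ?thesis
    using xs(2) unfolding word_ball_def
    by (intro CollectI exI[of _ "rev (map (m_inv G) xs)"] conjI) simp_all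
qed

end

end

lemma (in group_hom) hom_foldr_mult:
  "set xs \<subseteq> carrier G \<Longrightarrow>
     h (foldr (\<otimes>) xs \<one>) = foldr (\<otimes>\<^bsub>H\<^esub>) (map h xs) \<one>\<^bsub>H\<^esub>"
  by (induction xs) (auto simp: G.foldr_mult_closed)

text \<open>Since \<open>h\<close> respects inverses, it maps the letters over \<open>S\<close> onto
  the letters over the image of \<open>S\<close>, so words lift letter by letter. Having equality
  lets covering statements move in both directions between a quotient and \<open>G\<close>.\<close>

lemma (in group_hom) image_word_ball:
  assumes "S \<subseteq> carrier G"
  shows "h ` word_ball G S C = word_ball H (h ` S) C"
proof -
  let ?L = "S \<union> m_inv G ` S"
  have L: "?L \<subseteq> carrier G" using assms by auto
  have im: "h ` ?L = h ` S \<union> m_inv H ` h ` S"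
  proof -
    have "h (inv s) = inv\<^bsub>H\<^esub> (h s)" if "s \<in> S" for s using that assms by auto
    then show ?thesis by (force simp: image_Un image_image)
  qed
  show ?thesis
  proof (intro equalityI subsetI)
    fix y assume "y \<in> h ` word_ball G S C"
    then obtain xs where xs: "set xs \<subseteq> ?L" "length xs \<le> C" "y = h (foldr (\<otimes>) xs \<one>)"
      unfolding word_ball_def by blast
    then have "y = foldr (\<otimes>\<^bsub>H\<^esub>) (map h xs) \<one>\<^bsub>H\<^esub>" "set (map h xs) \<subseteq> h ` ?L"
      using hom_foldr_mult L by auto
    then show "y \<in> word_ball H (h ` S) C"
      unfolding word_ball_def using xs(2) im by (metis (mono_tags, lifting) length_map mem_Collect_eq)
  next
    fix y assume "y \<in> word_ball H (h ` S) C"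
    then obtain ys where ys: "set ys \<subseteq> h ` ?L" "length ys \<le> C"
        "y = foldr (\<otimes>\<^bsub>H\<^esub>) ys \<one>\<^bsub>H\<^esub>"
      unfolding word_ball_def im by blast
    then obtain xs where xs: "set xs \<subseteq> ?L" "ys = map h xs"
      by (metis imageE list.set_map lists_eq_set lists_image mem_Collect_eq)
    then have "y = h (foldr (\<otimes>) xs \<one>)" using ys hom_foldr_mult[of xs] L by (simp add: subset_trans)
    then show "y \<in> h ` word_ball G S C"
      using xs ys unfolding word_ball_def by auto
  qed
qed

section \<open>Commutators and the lower central series\<close>

declare lower_central.simps(2) [simp del]

definition commutator :: "('a, 'b) monoid_scheme \<Rightarrow> 'a \<Rightarrow> 'a \<Rightarrow> 'a" where
  "commutator G x y = x \<otimes>\<^bsub>G\<^esub> y \<otimes>\<^bsub>G\<^esub> inv\<^bsub>G\<^esub> x \<otimes>\<^bsub>G\<^esub> inv\<^bsub>G\<^esub> y"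

context group
begin

lemma inv_mult_cancel:
  assumes "x \<in> carrier G" "y \<in> carrier G"
  shows "inv x \<otimes> (x \<otimes> y) = y" "x \<otimes> (inv x \<otimes> y) = y"
  using assms by (simp_all flip: m_assoc)

lemma subset_set_mult:
  assumes "A \<subseteq> carrier G" "B \<subseteq> carrier G"
  shows "\<one> \<in> B \<Longrightarrow> A \<subseteq> A <#> B" "\<one> \<in> A \<Longrightarrow> B \<subseteq> A <#> B"
proof -
  show "A \<subseteq> A <#> B" if "\<one> \<in> B"
  proof
    fix x assume "x \<in> A"
    then have "x \<otimes> \<one> \<in> A <#> B" "x \<otimes> \<one> = x"
      using that assms unfolding set_mult_def by auto
    then show "x \<in> A <#> B" by simp
  qed
  show "B \<subseteq> A <#> B" if "\<one> \<in> A"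
  proof
    fix y assume "y \<in> B"
    then have "\<one> \<otimes> y \<in> A <#> B" "\<one> \<otimes> y = y"
      using that assms unfolding set_mult_def by auto
    then show "y \<in> A <#> B" by simp
  qed
qed

text \<open>Together with the simp rules for units and inverses, these rewrite a group word to a
  right-associated, freely reduced one, so word identities are settled by
  \<open>simp\<close>.\<close>

lemmas group_normalize = commutator_def m_assoc inv_mult_group inv_mult_cancel

lemma commutator_closed [simp, intro]:
  "\<lbrakk>x \<in> carrier G; y \<in> carrier G\<rbrakk> \<Longrightarrow> commutator G x y \<in> carrier G"
  by (simp add: commutator_def)

text \<open>Expanding in this form isolates the failure of linearity in a conjugation by
  \<open>y\<close>, which disappears modulo a suitable term of the lower central series.\<close>

lemma commutator_mult_right:
  "\<lbrakk>a \<in> carrier G; y \<in> carrier G; z \<in> carrier G\<rbrakk> \<Longrightarrow>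
     commutator G a (y \<otimes> z) = commutator G a y \<otimes> (y \<otimes> commutator G a z \<otimes> inv y)"
  by (simp add: group_normalize)

lemma commutator_inv_right:
  "\<lbrakk>a \<in> carrier G; y \<in> carrier G\<rbrakk> \<Longrightarrow>
     commutator G a (inv y) = inv y \<otimes> inv (commutator G a y) \<otimes> y"
  by (simp add: group_normalize)

lemma inv_commutator:
  "\<lbrakk>x \<in> carrier G; y \<in> carrier G\<rbrakk> \<Longrightarrow> inv (commutator G x y) = commutator G y x"
  by (simp add: group_normalize)

lemma commutator_eq_one:
  assumes "x \<in> carrier G" "y \<in> carrier G" "x \<otimes> y = y \<otimes> x"
  shows "commutator G x y = \<one>"
proof -
  have "commutator G x y = (y \<otimes> x) \<otimes> inv x \<otimes> inv y"
    unfolding commutator_def assms(3) by (rule refl)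
  then show ?thesis using assms(1,2) by (simp add: m_assoc inv_mult_cancel)
qed

lemma commutator_one [simp]:
  "x \<in> carrier G \<Longrightarrow> commutator G x \<one> = \<one>"
  by (simp add: commutator_def)

lemma conj_commutator:
  "\<lbrakk>g \<in> carrier G; x \<in> carrier G; y \<in> carrier G\<rbrakk> \<Longrightarrow>
     g \<otimes> commutator G x y \<otimes> inv g = commutator G (g \<otimes> x \<otimes> inv g) (g \<otimes> y \<otimes> inv g)"
  by (simp add: group_normalize)

lemma conj_eq_commutator_mult:
  "\<lbrakk>z \<in> carrier G; y \<in> carrier G\<rbrakk> \<Longrightarrow> y \<otimes> z \<otimes> inv y = commutator G y z \<otimes> z"
  by (simp add: group_normalize)

text \<open>The set is the preimage of the centralizer of the coset of \<open>a\<close> in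
  \<open>G Mod U\<close>. Hence \<open>[a, y]\<close> need only be tested against \<open>U\<close>
  for \<open>y\<close> in a generating set.\<close>

lemma subgroup_commutator_right:
  assumes "U \<lhd> G" "a \<in> carrier G"
  shows "subgroup {y \<in> carrier G. commutator G a y \<in> U} G"
proof -
  interpret U: normal U G by fact
  show ?thesis
    by (rule subgroupI)
      (use assms in \<open>auto simp: commutator_mult_right commutator_inv_right
          intro: U.inv_op_closed1 U.inv_op_closed2\<close>)
qed

lemma commutator_in_swap:
  assumes "subgroup U G" "x \<in> carrier G" "y \<in> carrier G"
  shows "commutator G x y \<in> U \<longleftrightarrow> commutator G y x \<in> U"
  using assms inv_commutator by (metis subgroup.m_inv_closed)

end

lemma (in group_hom) hom_commutator:
  "\<lbrakk>x \<in> carrier G; y \<in> carrier G\<rbrakk> \<Longrightarrow>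
     h (commutator G x y) = commutator H (h x) (h y)"
  by (simp add: commutator_def)

section \<open>The lower central series: normality, central factors, bilinearity of the
  commutator\<close>

context group
begin

lemma lower_central_Suc_eq:
  "lower_central G (Suc n) =
     generate G {commutator G x y | x y. x \<in> lower_central G n \<and> y \<in> carrier G}"
  by (auto intro!: arg_cong[where f = "generate G"] simp: commutator_def lower_central.simps(2))

lemma lower_central_normal: "lower_central G n \<lhd> G"
proof (induction n)
  case 0
  then show ?case by (simp add: normal_inv_iff subgroup_self)
next
  case (Suc n)
  interpret normal "lower_central G n" G by fact
  show ?case
    unfolding lower_central_Suc_eq
  proof (rule normal_generateI)
    fix h g assume "h \<in> {commutator G x y | x y. x \<in> lower_central G n \<and> y \<in> carrier G}"
      and g: "g \<in> carrier G"
    then obtain x y where "h = commutator G x y" "x \<in> lower_central G n" "y \<in> carrier G" by blast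
    then show "g \<otimes> h \<otimes> inv g \<in> {commutator G x y | x y. x \<in> lower_central G n \<and> y \<in> carrier G}"
      using g inv_op_closed2[of g x]
      by (force simp: conj_commutator)
  qed (use subset in auto)
qed

lemma lower_central_subgroup: "subgroup (lower_central G n) G"
  by (rule normal_imp_subgroup[OF lower_central_normal])

lemma lower_central_in_carrier: "x \<in> lower_central G n \<Longrightarrow> x \<in> carrier G"
  by (rule subgroup.mem_carrier[OF lower_central_subgroup])

lemma commutator_in_lower_central:
  "\<lbrakk>x \<in> lower_central G n; y \<in> carrier G\<rbrakk> \<Longrightarrow> commutator G x y \<in> lower_central G (Suc n)"
  unfolding lower_central_Suc_eq by (blast intro: generate.incl)

lemma lower_central_Suc_minimal:
  assumes "subgroup U G" "\<And>x y. \<lbrakk>x \<in> lower_central G n; y \<in> carrier G\<rbrakk> \<Longrightarrow> commutator G x y \<in> U"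
  shows "lower_central G (Suc n) \<subseteq> U"
  unfolding lower_central_Suc_eq by (rule generate_subgroup_incl) (use assms in auto)

lemma lower_central_Suc_subset: "lower_central G (Suc n) \<subseteq> lower_central G n"
proof (rule lower_central_Suc_minimal[OF lower_central_subgroup])
  interpret normal "lower_central G n" G by (rule lower_central_normal)
  fix x y assume "x \<in> lower_central G n" "y \<in> carrier G"
  \<comment> \<open>\<open>[x, y]\<close> is \<open>x\<close> times the conjugate of
    \<open>inv x\<close> by \<open>y\<close>.\<close>
  then show "commutator G x y \<in> lower_central G n"
    using inv_op_closed2[of y "inv x"] by (auto simp: commutator_def m_assoc)
qed

lemma derived_eq_lower_central: "derived G (carrier G) = lower_central G 1"
  by (simp add: derived_def lower_central.simps(2))

text \<open>Each factor of the series is central in the corresponding quotient of \<open>G\<close>: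
  conjugation by \<open>y\<close> multiplies \<open>z\<close> by \<open>[y, z]\<close>, which lies
  in the next term and therefore in \<open>U\<close>.\<close>

lemma normal_between_lower_central:
  assumes U: "subgroup U G" "lower_central G (Suc n) \<subseteq> U" "U \<subseteq> lower_central G n"
  shows "U \<lhd> G"
proof (rule normal_invI[OF U(1)])
  fix y z assume z: "y \<in> carrier G" "z \<in> U"
  then have zn: "z \<in> lower_central G n" "z \<in> carrier G" using U lower_central_in_carrier by blast+
  then have "commutator G y z \<in> U"
    using commutator_in_lower_central[OF zn(1) z(1)] commutator_in_swap U z by blast
  then show "y \<otimes> z \<otimes> inv y \<in> U"
    using z zn conj_eq_commutator_mult U(1) by (simp add: subgroup.m_closed)
qed

lemma rcos_conj_lower_central:
  assumes "y \<in> carrier G" "z \<in> lower_central G n"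
  shows "lower_central G (Suc n) #> (y \<otimes> z \<otimes> inv y) = lower_central G (Suc n) #> z"
proof -
  interpret M: normal "lower_central G (Suc n)" G by (rule lower_central_normal)
  have z: "z \<in> carrier G" using assms lower_central_in_carrier by blast
  have "commutator G y z \<in> lower_central G (Suc n)"
    using commutator_in_lower_central[OF assms(2,1)] commutator_in_swap[OF M.subgroup_axioms] z assms
    by blast
  then show ?thesis
    using z assms(1) M.subset M.rcos_const[OF is_group]
    by (metis coset_mult_assoc commutator_closed conj_eq_commutator_mult)
qed

lemma rcos_commute_lower_central:
  assumes "y \<in> carrier G" "z \<in> lower_central G n"
  shows "lower_central G (Suc n) #> (y \<otimes> z) = lower_central G (Suc n) #> (z \<otimes> y)"
proof -
  interpret M: normal "lower_central G (Suc n)" G by (rule lower_central_normal)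
  have z: "z \<in> carrier G" using assms lower_central_in_carrier by blast
  have "y \<otimes> z = (y \<otimes> z \<otimes> inv y) \<otimes> y" using assms z by (simp add: m_assoc)
  then have "lower_central G (Suc n) #> (y \<otimes> z)
      = (lower_central G (Suc n) #> (y \<otimes> z \<otimes> inv y)) <#> (lower_central G (Suc n) #> y)"
    using assms z by (simp add: M.rcos_sum)
  then show ?thesis
    using assms z rcos_conj_lower_central[OF assms] by (simp add: M.rcos_sum)
qed

text \<open>In the expansion of \<open>[a, y z]\<close> the second factor is a conjugate of
  \<open>[a, z]\<close>. As \<open>[a, z]\<close> lies in the term of index \<open>Suc n\<close>,
  conjugating it changes nothing modulo \<open>M\<close>.\<close>

lemma commutator_hom:
  assumes a: "a \<in> lower_central G n"
  defines "M \<equiv> lower_central G (Suc (Suc n))"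
  shows "group_hom G (G Mod M) (\<lambda>y. M #> commutator G a y)"
proof -
  interpret M: normal M G unfolding M_def by (rule lower_central_normal)
  have aG: "a \<in> carrier G" using a by (rule lower_central_in_carrier)
  have "(\<lambda>y. M #> commutator G a y) \<in> hom G (G Mod M)"
  proof (rule homI)
    fix y z assume yz: "y \<in> carrier G" "z \<in> carrier G"
    show "M #> commutator G a y \<in> carrier (G Mod M)"
      using aG yz by (auto simp: FactGroup_def RCOSETS_def)
    have "M #> (y \<otimes> commutator G a z \<otimes> inv y) = M #> commutator G a z"
      unfolding M_def using yz a by (intro rcos_conj_lower_central commutator_in_lower_central)
    then show "M #> commutator G a (y \<otimes> z)
        = (M #> commutator G a y) \<otimes>\<^bsub>G Mod M\<^esub> (M #> commutator G a z)"
      using aG yz M.rcos_sum[of "commutator G a y" "y \<otimes> commutator G a z \<otimes> inv y"]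
      by (simp add: FactGroup_def commutator_mult_right M.rcos_sum)
  qed
  then show ?thesis
    by (intro group_hom.intro group_hom_axioms.intro is_group M.factorgroup_is_group)
qed

text \<open>The homomorphism \<open>y \<mapsto> [a, y]\<close> has abelian image, so it kills the derived subgroup.\<close>

lemma commutator_derived:
  assumes a: "a \<in> lower_central G n" and z: "z \<in> lower_central G 1"
  shows "commutator G a z \<in> lower_central G (Suc (Suc n))"
proof -
  let ?M = "lower_central G (Suc (Suc n))"
  define f where "f = (\<lambda>y. ?M #> commutator G a y)"
  interpret M: normal ?M G by (rule lower_central_normal)
  have aG: "a \<in> carrier G" using a by (rule lower_central_in_carrier)
  interpret f: group_hom G "G Mod ?M" f
    unfolding f_def by (rule commutator_hom[OF a])
  have "lower_central G (Suc 0) \<subseteq> {y \<in> carrier G. commutator G a y \<in> ?M}"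
  proof (rule lower_central_Suc_minimal[OF subgroup_commutator_right[OF M.normal_axioms aG]])
    fix x y assume "x \<in> lower_central G 0" and y: "y \<in> carrier G"
    then have x: "x \<in> carrier G" by simp
    \<comment> \<open>The values of \<open>f\<close> are cosets of elements of the term of index
      \<open>Suc n\<close>, which is central modulo \<open>?M\<close>.\<close>
    have "f x \<otimes>\<^bsub>G Mod ?M\<^esub> f y = f y \<otimes>\<^bsub>G Mod ?M\<^esub> f x"
      using rcos_commute_lower_central[of "commutator G a x" "commutator G a y" "Suc n"]
        commutator_in_lower_central[OF a y] aG x y
      by (simp only: f_def mult_FactGroup M.rcos_sum commutator_closed)
    then have "f (commutator G x y) = \<one>\<^bsub>G Mod ?M\<^esub>"
      unfolding f.hom_commutator[OF x y]
      by (rule f.H.commutator_eq_one[OF f.hom_closed[OF x] f.hom_closed[OF y]])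
    then have "?M #> commutator G a (commutator G x y) = ?M" by (simp add: f_def)
    then have "commutator G a (commutator G x y) \<in> ?M"
      using coset_join1[OF _ _ M.subgroup_axioms] M.subset aG x y commutator_closed by metis
    then show "commutator G x y \<in> {y \<in> carrier G. commutator G a y \<in> ?M}"
      using x y by simp
  qed
  then show ?thesis using z by auto
qed

text \<open>Linearity in the first argument: for fixed \<open>y\<close>, the \<open>x\<close> with
  \<open>[y, x]\<close> in \<open>U\<close> form a subgroup. It contains \<open>A\<close>, and also
  the term of index \<open>Suc n\<close>, whose commutators fall into the term of index
  \<open>Suc (Suc n)\<close>.\<close>

lemma lower_central_Suc_subset_normal:
  assumes U: "U \<lhd> G" "lower_central G (Suc (Suc n)) \<subseteq> U"
    and A: "A \<subseteq> carrier G" "lower_central G n \<subseteq> generate G (A \<union> lower_central G (Suc n))"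
    and AU: "\<And>a y. \<lbrakk>a \<in> A; y \<in> carrier G\<rbrakk> \<Longrightarrow> commutator G a y \<in> U"
  shows "lower_central G (Suc n) \<subseteq> U"
proof (rule lower_central_Suc_minimal)
  show sU: "subgroup U G" using U normal_imp_subgroup by blast
  fix x y assume x: "x \<in> lower_central G n" and y: "y \<in> carrier G"
  have "A \<union> lower_central G (Suc n) \<subseteq> {x \<in> carrier G. commutator G y x \<in> U}"
    using A(1) AU[OF _ y] U(2) commutator_in_lower_central[OF _ y, of _ "Suc n"]
      commutator_in_swap[OF sU _ y] lower_central_in_carrier by blast
  then have "generate G (A \<union> lower_central G (Suc n)) \<subseteq> {x \<in> carrier G. commutator G y x \<in> U}"
    by (rule generate_subgroup_incl) (rule subgroup_commutator_right[OF U(1) y])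
  then show "commutator G x y \<in> U"
    using x A(2) commutator_in_swap[OF sU _ y] by blast
qed

section \<open>Bounded generation along the lower central series\<close>

context
  fixes S assumes S: "S \<subseteq> carrier G"
begin

lemma coset_word_ball_mult:
  assumes N: "N \<lhd> G" and x: "x \<in> N <#> word_ball G S C" and y: "y \<in> N <#> word_ball G S D"
  shows "x \<otimes> y \<in> N <#> word_ball G S (C + D)"
proof -
  interpret N: normal N G by fact
  obtain m v m' w where *: "m \<in> N" "v \<in> word_ball G S C" "x = m \<otimes> v"
      "m' \<in> N" "w \<in> word_ball G S D" "y = m' \<otimes> w"
    using x y unfolding set_mult_def by blast
  then have c: "m \<in> carrier G" "m' \<in> carrier G" "v \<in> carrier G" "w \<in> carrier G"
    using word_ball_in_carrier[OF S] by auto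
  \<comment> \<open>Normality of \<open>N\<close> allows \<open>m'\<close> to be moved to the left
    past \<open>v\<close>, at the price of a conjugation.\<close>
  then have "x \<otimes> y = (m \<otimes> (v \<otimes> m' \<otimes> inv v)) \<otimes> (v \<otimes> w)"
    using * by (simp add: group_normalize)
  moreover have "m \<otimes> (v \<otimes> m' \<otimes> inv v) \<in> N" using * c N.inv_op_closed2 by simp
  ultimately show ?thesis
    using word_ball_mult[OF S *(2,5)] unfolding set_mult_def by blast
qed

text \<open>Modulo \<open>lower_central G (n + 2)\<close>, \<open>[a, h]\<close> depends on \<open>h\<close> only through its class in the
  abelianization, so \<open>h\<close> can be taken to be a word of bounded length.\<close>

lemma commutator_word_ball:
  assumes C: "carrier G \<subseteq> lower_central G 1 <#> word_ball G S C"
    and a: "a \<in> lower_central G n" "a \<in> word_ball G S D" and h: "h \<in> carrier G"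
  shows "\<exists>w \<in> word_ball G S (D + C + D + C).
    lower_central G (Suc (Suc n)) #> commutator G a h = lower_central G (Suc (Suc n)) #> w"
proof -
  let ?M = "lower_central G (Suc (Suc n))"
  define f where "f = (\<lambda>y. ?M #> commutator G a y)"
  interpret M: normal ?M G by (rule lower_central_normal)
  interpret f: group_hom G "G Mod ?M" f
    unfolding f_def by (rule commutator_hom[OF a(1)])
  obtain z v where zv: "z \<in> lower_central G 1" "v \<in> word_ball G S C" "h = z \<otimes> v"
    using C h unfolding set_mult_def by blast
  have c: "z \<in> carrier G" "v \<in> carrier G"
    using zv lower_central_in_carrier word_ball_in_carrier[OF S] by blast+
  have "f z = ?M"
    unfolding f_def using commutator_derived[OF a(1) zv(1)] by (rule M.rcos_const[OF is_group])
  then have "f h = \<one>\<^bsub>G Mod ?M\<^esub> \<otimes>\<^bsub>G Mod ?M\<^esub> f v"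
    using f.hom_mult[OF c] zv(3) by simp
  then have "f h = f v" using f.H.l_one[OF f.hom_closed[OF c(2)]] by simp
  \<comment> \<open>The four factors \<open>a\<close>, \<open>v\<close>, \<open>inv a\<close>,
    \<open>inv v\<close> account for the four summands. The bound depends on \<open>a\<close> but
    not on \<open>h\<close>, which is the uniformity required.\<close>
  moreover have "commutator G a v \<in> word_ball G S (D + C + D + C)"
    unfolding commutator_def by (intro word_ball_mult word_ball_inv S a zv)
  ultimately show ?thesis unfolding f_def by blast
qed

text \<open>Modulo the term of index \<open>Suc (Suc n)\<close>, \<open>W\<close> is the product
  over \<open>a\<close> in \<open>A\<close> of the images of the homomorphisms sending
  \<open>y\<close> to \<open>[a, y]\<close>. Every element of one such image is a single commutator,
  hence a word of bounded length, and as \<open>A\<close> is finite the bounds add up to a bound for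
  \<open>W\<close>.\<close>

lemma ex_bounded_subgroup:
  assumes C: "carrier G \<subseteq> lower_central G 1 <#> word_ball G S C"
    and A: "finite A" "A \<subseteq> lower_central G n" "A \<subseteq> (\<Union>D. word_ball G S D)"
  shows "\<exists>W D. subgroup W G \<and> lower_central G (Suc (Suc n)) \<subseteq> W \<and> W \<subseteq> lower_central G (Suc n) \<and>
    W \<subseteq> lower_central G (Suc (Suc n)) <#> word_ball G S D \<and>
    (\<forall>a\<in>A. \<forall>h\<in>carrier G. commutator G a h \<in> W)"
  using A
proof (induction A)
  case empty
  let ?M = "lower_central G (Suc (Suc n))"
  have "?M \<subseteq> ?M <#> word_ball G S 0"
    by (rule subset_set_mult(1)[OF subgroup.subset[OF lower_central_subgroup]
          word_ball_in_carrier[OF S] one_in_word_ball[OF S]])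
  then show ?case
    by (intro exI[of _ ?M] exI[of _ 0] conjI lower_central_subgroup lower_central_Suc_subset) simp_all
next
  case (insert a A)
  let ?M = "lower_central G (Suc (Suc n))"
  define f where "f = (\<lambda>y. ?M #> commutator G a y)"
  interpret M: normal ?M G by (rule lower_central_normal)
  obtain W D where W: "subgroup W G" "?M \<subseteq> W" "W \<subseteq> lower_central G (Suc n)"
      "W \<subseteq> ?M <#> word_ball G S D" "\<forall>a\<in>A. \<forall>h\<in>carrier G. commutator G a h \<in> W"
    using insert by auto
  have a: "a \<in> lower_central G n" using insert by auto
  have aG: "a \<in> carrier G" using a by (rule lower_central_in_carrier)
  obtain D' where D': "a \<in> word_ball G S D'" using insert by auto
  interpret f: group_hom G "G Mod ?M" f
    unfolding f_def by (rule commutator_hom[OF a])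
  \<comment> \<open>Commutators with \<open>a\<close> form a subgroup only modulo \<open>?M\<close>,
    so \<open>V\<close> is taken as the full preimage in \<open>G\<close> of the image of
    \<open>f\<close>.\<close>
  define V where "V = {g \<in> carrier G. ?M #> g \<in> f ` carrier G}"
  have VI: "g \<in> V" if "g \<in> carrier G" "h \<in> carrier G" "?M #> g = f h" for g h
    using that unfolding V_def by blast
  have V: "subgroup V G"
  proof (rule subgroupI)
    show "V \<subseteq> carrier G" unfolding V_def by blast
    show "V \<noteq> {}" using VI[of \<one> \<one>] f_def aG by auto
  next
    fix g assume "g \<in> V"
    then obtain h where h: "g \<in> carrier G" "h \<in> carrier G" "?M #> g = f h" unfolding V_def by blast
    then have "?M #> inv g = f (inv h)"
      using M.rcos_inv M.inv_FactGroup f.hom_inv f.hom_closed by metis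
    then show "inv g \<in> V" using h by (intro VI[of _ "inv h"]) auto
  next
    fix g g' assume "g \<in> V" "g' \<in> V"
    then obtain h h' where h: "g \<in> carrier G" "h \<in> carrier G" "?M #> g = f h"
      "g' \<in> carrier G" "h' \<in> carrier G" "?M #> g' = f h'" unfolding V_def by blast
    then have "?M #> (g \<otimes> g') = f (h \<otimes> h')"
      using f.hom_mult[of h h'] by (simp add: FactGroup_def flip: M.rcos_sum)
    then show "g \<otimes> g' \<in> V" using h by (intro VI[of _ "h \<otimes> h'"]) auto
  qed
  have MV: "?M \<subseteq> V"
  proof
    fix m assume "m \<in> ?M"
    then show "m \<in> V"
      using aG M.subset M.rcos_const[OF is_group, of m] M.rcos_const[OF is_group, of \<one>]
      by (intro VI[of m \<one>]) (auto simp: f_def)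
  qed
  have VE: "\<exists>m\<in>?M. g = m \<otimes> w" if "g \<in> carrier G" "?M #> g = ?M #> w" for g w
    using rcos_self[OF that(1) M.subgroup_axioms] that(2) unfolding r_coset_def by auto
  have VL: "V \<subseteq> lower_central G (Suc n)"
  proof
    fix g assume "g \<in> V"
    then obtain h m where "h \<in> carrier G" "m \<in> ?M" "g = m \<otimes> commutator G a h"
      using VE unfolding V_def f_def by blast
    then show "g \<in> lower_central G (Suc n)"
      using commutator_in_lower_central[OF a] lower_central_Suc_subset
      by (metis lower_central_subgroup subgroup.m_closed subsetD)
  qed
  have VB: "V \<subseteq> ?M <#> word_ball G S (D' + C + D' + C)"
  proof
    fix g assume "g \<in> V"
    then obtain h where h: "g \<in> carrier G" "h \<in> carrier G" "?M #> g = f h" unfolding V_def by blast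
    obtain w where "w \<in> word_ball G S (D' + C + D' + C)" "f h = ?M #> w"
      unfolding f_def using commutator_word_ball[OF C a D' h(2)] by blast
    then show "g \<in> ?M <#> word_ball G S (D' + C + D' + C)"
      using VE[of g w] h unfolding set_mult_def by auto
  qed
  have VW: "V \<subseteq> V <#> W" "W \<subseteq> V <#> W"
    using subset_set_mult subgroup.one_closed[OF V] subgroup.one_closed[OF W(1)]
      subgroup.subset[OF V] subgroup.subset[OF W(1)] by auto
  \<comment> \<open>\<open>V\<close> is normal, lying between consecutive terms of the series, so
    its product with the subgroup \<open>W\<close> is a subgroup.\<close>
  have "subgroup (V <#> W) G"
    by (rule mult_norm_subgroup[OF normal_between_lower_central[OF V MV VL] W(1)])
  moreover have "V <#> W \<subseteq> lower_central G (Suc n)"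
    using VL W(3) subgroup.m_closed[OF lower_central_subgroup] unfolding set_mult_def by blast
  moreover have "V <#> W \<subseteq> ?M <#> word_ball G S (D' + C + D' + C + D)"
    using coset_word_ball_mult[OF M.normal_axioms] VB W(4) unfolding set_mult_def[of G V W] by blast
  moreover have "commutator G a h \<in> V" if "h \<in> carrier G" for h
    using that aG by (intro VI[of _ h]) (auto simp: f_def)
  then have "\<forall>b\<in>insert a A. \<forall>h\<in>carrier G. commutator G b h \<in> V <#> W"
    using W(5) VW by blast
  moreover have "?M \<subseteq> V <#> W" using MV VW(1) by (rule subset_trans)
  ultimately show ?case
    by (intro exI[of _ "V <#> W"] exI[of _ "D' + C + D' + C + D"] conjI)
qed

text \<open>By bilinearity, commutators of generators of one factor with generators of the
  abelianization generate the next factor. Starting from words in \<open>S\<close>, only words in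
  \<open>S\<close> arise; this is what later makes \<open>[a, h]\<close> a bounded word whenever
  \<open>h\<close> is one.\<close>

lemma lower_central_layer:
  assumes C: "carrier G \<subseteq> lower_central G 1 <#> word_ball G S C"
    and E: "finite E" "E \<subseteq> (\<Union>D. word_ball G S D)" "carrier G = generate G (E \<union> lower_central G 1)"
  shows "\<exists>A. finite A \<and> A \<subseteq> lower_central G n \<and> A \<subseteq> (\<Union>D. word_ball G S D) \<and>
    lower_central G n \<subseteq> generate G (A \<union> lower_central G (Suc n))"
proof (induction n)
  case 0
  then show ?case
    using E word_ball_in_carrier[OF S] by (intro exI[of _ E]) auto
next
  case (Suc n)
  then obtain A where A: "finite A" "A \<subseteq> lower_central G n" "A \<subseteq> (\<Union>D. word_ball G S D)"
    "lower_central G n \<subseteq> generate G (A \<union> lower_central G (Suc n))" by blast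
  have AG: "A \<subseteq> carrier G" using A(2) lower_central_in_carrier by blast
  have EG: "E \<subseteq> carrier G" using E(2) word_ball_in_carrier[OF S] by blast
  let ?B = "(\<lambda>(a, e). commutator G a e) ` (A \<times> E)"
  let ?M = "lower_central G (Suc (Suc n))"
  \<comment> \<open>Including \<open>?M\<close> among the generators places \<open>?U\<close>
    between consecutive terms, so that it is normal and commutators can be studied modulo
    it.\<close>
  let ?U = "generate G (?B \<union> ?M)"
  have BL: "?B \<subseteq> lower_central G (Suc n)"
    using A(2) EG by (auto intro: commutator_in_lower_central)
  have BU: "?B \<subseteq> ?U" "?M \<subseteq> ?U" by (auto intro: generate.incl)
  have UL: "?U \<subseteq> lower_central G (Suc n)"
    using BL lower_central_Suc_subset[of "Suc n"]
    by (intro generate_subgroup_incl[OF _ lower_central_subgroup]) blast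
  have sU: "subgroup ?U G"
    using BL lower_central_in_carrier by (intro generate_is_subgroup) blast
  have nU: "?U \<lhd> G" by (rule normal_between_lower_central[OF sU BU(2) UL])
  have "commutator G a y \<in> ?U" if a: "a \<in> A" and y: "y \<in> carrier G" for a y
  proof -
    \<comment> \<open>It suffices to test generators \<open>y\<close>: those in \<open>E\<close> are
      covered by the choice of \<open>?B\<close>, and those in the derived subgroup give commutators
      in \<open>?M\<close>.\<close>
    have "E \<union> lower_central G 1 \<subseteq> {y \<in> carrier G. commutator G a y \<in> ?U}"
    proof -
      have "commutator G a e \<in> ?U" if "e \<in> E" for e
        using BU(1) a that by blast
      moreover have "commutator G a z \<in> ?U" if "z \<in> lower_central G 1" for z
        using commutator_derived[OF _ that, of a n] a A(2) BU(2) by blast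
      ultimately show ?thesis using EG lower_central_in_carrier[of _ 1] by blast
    qed
    then have "generate G (E \<union> lower_central G 1) \<subseteq> {y \<in> carrier G. commutator G a y \<in> ?U}"
      using a AG by (intro generate_subgroup_incl subgroup_commutator_right[OF nU]) auto
    then show ?thesis using E(3) y by blast
  qed
  then have "lower_central G (Suc n) \<subseteq> ?U"
    by (rule lower_central_Suc_subset_normal[OF nU BU(2) AG A(4)])
  moreover have "?B \<subseteq> (\<Union>D. word_ball G S D)"
  proof clarsimp
    fix a e assume "a \<in> A" "e \<in> E"
    then obtain D D' where "a \<in> word_ball G S D" "e \<in> word_ball G S D'" using A(3) E(2) by blast
    then have "commutator G a e \<in> word_ball G S (D + D' + D + D')"
      unfolding commutator_def by (intro word_ball_mult word_ball_inv S)
    then show "\<exists>D. commutator G a e \<in> word_ball G S D" by blast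
  qed
  ultimately show ?case using A(1) E(1) BL by (intro exI[of _ ?B]) auto
qed

text \<open>Induction on the depth: an element is \<open>z w\<close> with \<open>w\<close> a bounded
  word and \<open>z\<close> in the term of index \<open>Suc n\<close>, and modulo the next term
  \<open>z\<close> is a bounded word too. The indices start at 1, where the claim is the hypothesis
  on the abelianization.\<close>

lemma lower_central_cosets_bounded:
  assumes C: "carrier G \<subseteq> lower_central G 1 <#> word_ball G S C"
    and E: "finite E" "E \<subseteq> (\<Union>D. word_ball G S D)" "carrier G = generate G (E \<union> lower_central G 1)"
  shows "\<exists>D. carrier G \<subseteq> lower_central G (Suc n) <#> word_ball G S D"
proof (induction n)
  case 0
  then show ?case using C by auto
next
  case (Suc n)
  then obtain D where D: "carrier G \<subseteq> lower_central G (Suc n) <#> word_ball G S D" by blast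
  let ?M = "lower_central G (Suc (Suc n))"
  obtain A where A: "finite A" "A \<subseteq> lower_central G n" "A \<subseteq> (\<Union>D. word_ball G S D)"
    "lower_central G n \<subseteq> generate G (A \<union> lower_central G (Suc n))"
    using lower_central_layer[OF C E, of n] by blast
  obtain W D' where W: "subgroup W G" "?M \<subseteq> W" "W \<subseteq> lower_central G (Suc n)"
      "W \<subseteq> ?M <#> word_ball G S D'" "\<forall>a\<in>A. \<forall>h\<in>carrier G. commutator G a h \<in> W"
    using ex_bounded_subgroup[OF C A(1-3)] by blast
  \<comment> \<open>\<open>A\<close> generates the factor of index \<open>n\<close>, and
    \<open>W\<close> contains all commutators with elements of \<open>A\<close>, so \<open>W\<close>
    is the whole term of index \<open>Suc n\<close>.\<close>
  have "lower_central G (Suc n) \<subseteq> W"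
    using W A lower_central_in_carrier
    by (intro lower_central_Suc_subset_normal[OF normal_between_lower_central[OF W(1-3)] W(2) _ A(4)]) blast+
  then have L: "lower_central G (Suc n) \<subseteq> ?M <#> word_ball G S D'" using W(4) by blast
  have wb: "word_ball G S D \<subseteq> ?M <#> word_ball G S D"
    by (rule subset_set_mult(2)[OF subgroup.subset[OF lower_central_subgroup]
          word_ball_in_carrier[OF S] subgroup.one_closed[OF lower_central_subgroup]])
  have "carrier G \<subseteq> ?M <#> word_ball G S (D' + D)"
  proof
    fix g assume "g \<in> carrier G"
    then obtain z w where "z \<in> lower_central G (Suc n)" "w \<in> word_ball G S D" "g = z \<otimes> w"
      using D unfolding set_mult_def by blast
    then show "g \<in> ?M <#> word_ball G S (D' + D)"
      using coset_word_ball_mult[OF lower_central_normal] L wb by blast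
  qed
  then show ?case by blast
qed

end

end

section \<open>Quotients and direct sums\<close>

lemma (in group_hom) hom_lower_central:
  "x \<in> lower_central G n \<Longrightarrow> h x \<in> lower_central H n"
proof (induction n arbitrary: x)
  case 0
  then show ?case by simp
next
  case (Suc n)
  let ?L = "lower_central H (Suc n)"
  interpret L: subgroup ?L H by (rule H.lower_central_subgroup)
  have "subgroup {x \<in> carrier G. h x \<in> ?L} G"
    by (rule G.subgroupI) (auto intro: exI[of _ \<one>])
  then have "lower_central G (Suc n) \<subseteq> {x \<in> carrier G. h x \<in> ?L}"
    using Suc.IH G.lower_central_in_carrier
    by (intro G.lower_central_Suc_minimal) (auto simp: hom_commutator intro: H.commutator_in_lower_central)
  then show ?case using Suc.prems by blast
qed

lemma (in group) coset_proj_group_hom: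
  assumes "N \<lhd> G"
  shows "group_hom G (G Mod N) (coset_proj G N)"
proof -
  interpret normal N G by fact
  have eq: "coset_proj G N = (\<lambda>g. N #> g)" by (rule ext) (rule coset_proj_def)
  show ?thesis
    unfolding eq
    by (intro group_hom.intro group_hom_axioms.intro is_group factorgroup_is_group r_coset_hom_Mod)
qed

lemma (in group) coset_proj_image_carrier:
  "coset_proj G N ` carrier G = carrier (G Mod N)"
  by (auto simp: coset_proj_def FactGroup_def RCOSETS_def)

text \<open>This translates diameter bounds in a quotient into coverings of \<open>G\<close> by
  cosets of words, so that the induction along the series takes place inside
  \<open>G\<close>.\<close>

lemma (in group) carrier_FactGroup_word_ball_iff:
  assumes N: "N \<lhd> G" and S: "S \<subseteq> carrier G"
  shows "carrier (G Mod N) \<subseteq> word_ball (G Mod N) (coset_proj G N ` S) C \<longleftrightarrow>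
    carrier G \<subseteq> N <#> word_ball G S C"
proof -
  interpret N: normal N G by (rule N)
  interpret p: group_hom G "G Mod N" "coset_proj G N" by (rule coset_proj_group_hom[OF N])
  have coset: "coset_proj G N g = coset_proj G N w \<longleftrightarrow> (\<exists>m\<in>N. g = m \<otimes> w)"
    if "g \<in> carrier G" "w \<in> carrier G" for g w
  proof
    assume "coset_proj G N g = coset_proj G N w"
    then show "\<exists>m\<in>N. g = m \<otimes> w"
      using rcos_self[OF that(1) N.subgroup_axioms] unfolding coset_proj_def r_coset_def by auto
  next
    assume "\<exists>m\<in>N. g = m \<otimes> w"
    then obtain m where m: "m \<in> N" "g = m \<otimes> w" by blast
    then have "N #> g = (N #> m) #> w"
      using that coset_mult_assoc[OF N.subset, of m w] by auto
    then show "coset_proj G N g = coset_proj G N w"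
      using N.rcos_const[OF is_group m(1)] by (simp add: coset_proj_def)
  qed
  have "carrier (G Mod N) \<subseteq> word_ball (G Mod N) (coset_proj G N ` S) C \<longleftrightarrow>
      (\<forall>g\<in>carrier G. \<exists>w\<in>word_ball G S C. coset_proj G N g = coset_proj G N w)"
    unfolding p.image_word_ball[OF S, symmetric] coset_proj_image_carrier[symmetric]
    by (auto simp: subset_iff)
  also have "\<dots> \<longleftrightarrow> (\<forall>g\<in>carrier G. \<exists>w\<in>word_ball G S C. \<exists>m\<in>N. g = m \<otimes> w)"
    using coset word_ball_in_carrier[OF S] by (meson subsetD)
  also have "\<dots> \<longleftrightarrow> carrier G \<subseteq> N <#> word_ball G S C"
    unfolding set_mult_def by blast
  finally show ?thesis .
qed

theorem (in group) nilpotent_bounded_if_abelianization_bounded: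
  assumes fg: "finitely_generated_group G" and S: "S \<subseteq> carrier G"
    and ab: "generates_with_finite_diameter (abelianization G) (coset_proj G (derived G (carrier G)) ` S)"
  shows "nilpotent_bounded G S"
proof -
  obtain C where C: "carrier G \<subseteq> lower_central G 1 <#> word_ball G S C"
    using ab carrier_FactGroup_word_ball_iff[OF lower_central_normal S]
    unfolding generates_with_finite_diameter_iff abelianization_def derived_eq_lower_central by blast
  obtain F where F: "finite F" "F \<subseteq> carrier G" "generate G F = carrier G"
    using fg unfolding finitely_generated_group_def by blast
  \<comment> \<open>Each of the finitely many generators is replaced by a word in \<open>S\<close>
    congruent to it modulo the derived subgroup. These words, with the derived subgroup, still
    generate \<open>G\<close>.\<close>
  have "\<forall>g\<in>F. \<exists>w\<in>word_ball G S C. \<exists>z\<in>lower_central G 1. g = z \<otimes> w"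
    using C F(2) unfolding set_mult_def by blast
  then obtain w where w: "\<And>g. g \<in> F \<Longrightarrow> w g \<in> word_ball G S C"
      "\<And>g. g \<in> F \<Longrightarrow> \<exists>z\<in>lower_central G 1. g = z \<otimes> w g"
    by metis
  let ?E = "w ` F"
  have EG: "?E \<union> lower_central G 1 \<subseteq> carrier G"
    using w(1) word_ball_in_carrier[OF S] lower_central_in_carrier[of _ 1] by blast
  have sub: "subgroup (generate G (?E \<union> lower_central G 1)) G"
    by (rule generate_is_subgroup[OF EG])
  have "F \<subseteq> generate G (?E \<union> lower_central G 1)"
  proof
    fix g assume g: "g \<in> F"
    then obtain z where "z \<in> lower_central G 1" "g = z \<otimes> w g" using w(2) by blast
    then show "g \<in> generate G (?E \<union> lower_central G 1)"
      using g by (metis UnI1 UnI2 generate.eng generate.incl imageI)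
  qed
  then have E: "carrier G = generate G (?E \<union> lower_central G 1)"
    using generate_subgroup_incl[OF _ sub] F(3) subgroup.subset[OF sub] by blast
  have E': "finite ?E" "?E \<subseteq> (\<Union>D. word_ball G S D)"
    using F(1) w(1) by auto
  show ?thesis
    unfolding nilpotent_bounded_def
  proof (intro conjI allI impI)
    fix N assume "N \<lhd> G \<and> nilpotent_group (G Mod N)"
    then obtain n where N: "N \<lhd> G" and n: "lower_central (G Mod N) n = {\<one>\<^bsub>G Mod N\<^esub>}"
      unfolding nilpotent_group_def by blast
    interpret N: normal N G by (rule N)
    interpret p: group_hom G "G Mod N" "coset_proj G N" by (rule coset_proj_group_hom[OF N])
    \<comment> \<open>The projection sends the term of index \<open>n\<close> into the trivial term
      of the quotient. The index \<open>Suc n\<close> is used because the coverings are available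
      from index 1 on, while \<open>n\<close> may be 0.\<close>
    have "lower_central G (Suc n) \<subseteq> N"
    proof
      fix x assume "x \<in> lower_central G (Suc n)"
      then have x: "x \<in> lower_central G n" using lower_central_Suc_subset by blast
      then have "N #> x = N"
        using p.hom_lower_central[OF x] n by (simp add: coset_proj_def)
      then show "x \<in> N"
        using rcos_self[OF lower_central_in_carrier[OF x] N.subgroup_axioms] by simp
    qed
    moreover obtain D where "carrier G \<subseteq> lower_central G (Suc n) <#> word_ball G S D"
      using lower_central_cosets_bounded[OF S C E'(1,2) E, of n] by blast
    ultimately have "carrier G \<subseteq> N <#> word_ball G S D"
      unfolding set_mult_def by blast
    then show "generates_with_finite_diameter (G Mod N) (coset_proj G N ` S)"
      unfolding generates_with_finite_diameter_iff
      using carrier_FactGroup_word_ball_iff[OF N S] S p.hom_closed by blast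
  qed (rule S)
qed

section \<open>Bounded generation of finite direct sums\<close>

lemma (in group) word_ball_subgroup:
  assumes "subgroup K G" "S \<subseteq> K"
  shows "word_ball (G\<lparr>carrier := K\<rparr>) S C = word_ball G S C"
proof -
  \<comment> \<open>The definition of \<open>m_inv\<close> refers to the carrier, so the inverse
    letters have to be compared when the carrier shrinks to \<open>K\<close>.\<close>
  have "m_inv (G\<lparr>carrier := K\<rparr>) ` S = m_inv G ` S"
    using assms by (intro image_cong) (auto intro: m_inv_consistent)
  then show ?thesis by (simp add: word_ball_def)
qed

lemma (in comm_group) internal_direct_sum_bounded:
  assumes ds: "internal_direct_sum G I K" and I: "finite I"
    and T: "\<And>i. i \<in> I \<Longrightarrow> generates_with_finite_diameter (G\<lparr>carrier := K i\<rparr>) (T i)"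
  shows "generates_with_finite_diameter G (\<Union>i\<in>I. T i)"
proof -
  have K: "subgroup (K i) G" if "i \<in> I" for i
    using ds that unfolding internal_direct_sum_def by blast
  have TK: "T i \<subseteq> K i" if "i \<in> I" for i
    using T[OF that] unfolding generates_with_finite_diameter_iff by simp
  have UT: "(\<Union>i\<in>I. T i) \<subseteq> carrier G"
    using TK subgroup.subset[OF K] by blast
  have "\<exists>C. K i \<subseteq> word_ball G (T i) C" if "i \<in> I" for i
    using T[OF that] word_ball_subgroup[OF K TK] that
    unfolding generates_with_finite_diameter_iff by simp
  then obtain C where C: "\<And>i. i \<in> I \<Longrightarrow> K i \<subseteq> word_ball G (T i) (C i)" by metis
  \<comment> \<open>Stated for subsets \<open>J\<close> of \<open>I\<close> to allow induction;
    adding a summand multiplies by one more component, and the radii add.\<close>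
  have step: "finprod G x J \<in> word_ball G (\<Union>i\<in>I. T i) (sum C J)"
    if "finite J" "J \<subseteq> I" "\<And>i. i \<in> I \<Longrightarrow> x i \<in> K i" for x J
    using that(1,2)
  proof (induction J)
    case empty
    then show ?case by (simp add: one_in_word_ball[OF UT])
  next
    case (insert j J)
    have xj: "x j \<in> word_ball G (\<Union>i\<in>I. T i) (C j)"
      using insert.prems that(3)[of j] C[of j] word_ball_mono[of "T j" "\<Union>i\<in>I. T i" "C j" "C j" G]
      by blast
    have "x i \<in> carrier G" if "i \<in> insert j J" for i
      using insert.prems \<open>\<And>i. i \<in> I \<Longrightarrow> x i \<in> K i\<close> subgroup.subset[OF K] that by blast
    then have "finprod G x (insert j J) = x j \<otimes> finprod G x J"
      using insert.hyps by (intro finprod_insert) auto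
    then show ?case
      using word_ball_mult[OF UT xj insert.IH] insert.prems insert.hyps by simp
  qed
  have "carrier G \<subseteq> word_ball G (\<Union>i\<in>I. T i) (sum C I)"
  proof
    fix q assume "q \<in> carrier G"
    \<comment> \<open>Surjectivity of the canonical map supplies the components of
      \<open>q\<close>.\<close>
    moreover have "(\<lambda>x. finprod G x I) ` carrier (sum_group I (\<lambda>i. G\<lparr>carrier := K i\<rparr>)) = carrier G"
      using ds unfolding internal_direct_sum_def iso_def bij_betw_def by blast
    ultimately obtain x where "x \<in> carrier (sum_group I (\<lambda>i. G\<lparr>carrier := K i\<rparr>))"
        "q = finprod G x I" by blast
    moreover from this have "x i \<in> K i" if "i \<in> I" for i
      using that K by (auto simp: carrier_sum_group subgroup_imp_group PiE_iff)
    ultimately show "q \<in> word_ball G (\<Union>i\<in>I. T i) (sum C I)"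
      using step[OF I] by blast
  qed
  then show ?thesis
    using UT unfolding generates_with_finite_diameter_iff by blast
qed

theorem corollary1p3:
  fixes G :: "('a, 'b) monoid_scheme"
    and k :: nat
    and Hs :: "nat \<Rightarrow> 'a set set"
    and S :: "nat \<Rightarrow> 'a set"
  assumes "finitely_generated_group G"
    and "internal_direct_sum (abelianization G) {1..k} Hs"
    and "\<And>i. i \<in> {1..k} \<Longrightarrow> S i \<subseteq> carrier G"
    and "\<And>i. i \<in> {1..k} \<Longrightarrow> coset_proj G (derived G (carrier G)) ` S i \<subseteq> Hs i"
    and "\<And>i. i \<in> {1..k} \<Longrightarrow>
           generates_with_finite_diameter ((abelianization G)\<lparr>carrier := Hs i\<rparr>)
             (coset_proj G (derived G (carrier G)) ` S i)"
  shows "nilpotent_bounded G (\<Union>i\<in>{1..k}. S i)"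
proof -
  interpret group G using assms(1) by (simp add: finitely_generated_group_def)
  interpret H: comm_group "abelianization G"
    unfolding abelianization_def by (rule derived_quot_is_comm_group)
  have "generates_with_finite_diameter (abelianization G)
      (\<Union>i\<in>{1..k}. coset_proj G (derived G (carrier G)) ` S i)"
    by (rule H.internal_direct_sum_bounded[OF assms(2) _ assms(5)]) simp_all
  then have "generates_with_finite_diameter (abelianization G)
      (coset_proj G (derived G (carrier G)) ` (\<Union>i\<in>{1..k}. S i))"
    by (simp only: image_UN)
  moreover have "(\<Union>i\<in>{1..k}. S i) \<subseteq> carrier G"
    using assms(3) by blast
  ultimately show ?thesis
    by (intro nilpotent_bounded_if_abelianization_bounded[OF assms(1)])
qed

end
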